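(* Assume $p<d<n$ and that $\boldsymbol\Sigma$ is positive definite. For the weighted least squares model with weight matrix $\mathbf W$ and design matrix $\mathbf X_p$ (the weights $\mathbf W$ being used both for model fitting and for model evaluation), the increment $\Delta\mathrm{df}_{\rm R}(p)=\mathrm{df}_{\rm R}(p+1)-\mathrm{df}_{\rm R}(p)$ of the predictive model degrees of freedom satisfies $$\begin{aligned}\Delta\mathrm{df}_{\rm R}(p)=\frac12\Delta\mathrm{df}_{\rm F}(p)&+\frac n2\,\Delta\mathrm{df}_{\rm F}(p)\,\frac{\|\tilde{\mathbf x}_{(p+1)}-\tilde{\mathbf X}_p\boldsymbol\Sigma_p^{-1}\boldsymbol\phi_{p,p+1}\|_{\mathbf M}^2+a_{p,p+1}}{\|\tilde{\mathbf r}_{(p+1)}\|^2}\\&-n\,\frac{\langle\tilde{\mathbf r}_{(p+1)},\ \tilde{\mathbf x}_{(p+1)}-\tilde{\mathbf X}_p\boldsymbol\Sigma_p^{-1}\boldsymbol\phi_{p,p+1}\rangle_{\mathbf U\mathbf M}}{\|\tilde{\mathbf r}_{(p+1)}\|^2},\end{aligned}$$ where $\Delta\mathrm{df}_{\rm F}(p)=\mathrm{df}_{\rm F}(p+1)-\mathrm{df}_{\rm F}(p)$, $\mathbf U=\frac1{\bar w}\mathbf W^{1/2}\mathbf T\mathbf W^{1/2}$ and $\mathbf M=\tilde{\mathbf X}_p(\tilde{\mathbf X}_p^\top\tilde{\mathbf X}_p)^{-1}\boldsymbol\Sigma_p(\tilde{\mathbf X}_p^\top\tilde{\mathbf X}_p)^{-1}\tilde{\mathbf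 X}_p^\top$.
   Context: Setting: $\mathbf X\in\mathbb R^{n\times d}$ is a design matrix of full column rank with rows $\mathbf x_1^\top,\dots,\mathbf x_n^\top$ and columns $\mathbf x_{(1)},\dots,\mathbf x_{(d)}\in\mathbb R^n$ (one column per variable). The responses $\mathbf y\in\mathbb R^n$ satisfy $\mathrm{Var}(\mathbf y\mid\mathbf X)=\sigma_\varepsilon^2\mathbf T$ with $\sigma_\varepsilon^2>0$ and $\mathbf T=\mathrm{diag}(\tau_1,\dots,\tau_n)$, $\tau_i=\tau(\mathbf x_i)>0$. A positive weight function $w$ gives $w_i=w(\mathbf x_i)>0$, $\mathbf W=\mathrm{diag}(w_1,\dots,w_n)$, $\bar w=\frac1n\sum_{i=1}^n w_i$. $\mathbf x_\ast\in\mathbb R^d$ is a new covariate vector, an independent copy of $\mathbf x_i$, $w_\ast=w(\mathbf x_\ast)$, and $\boldsymbol\Sigma=\mathrm E(w_\ast\mathbf x_\ast\mathbf x_\ast^\top)/\bar w$ (the expectation is over $\mathbf x_\ast$ only). Subset regression: variables enter along a nested sequence of subsets $\mathcal S_1\subset\cdots\subset\mathcal S_d=\{1,\dots,d\}$ with $|\mathcal S_p|=p$; variables are labelled in order of entry, so $\mathbf X_p=(\mathbf x_{(1)},\dots,\mathbf x_{(p)})$, $\mathbf X_{p+1}=(\mathbf X_p,\mathbf x_{(p+1)})$, and $\boldsymbol\Sigma_p$ is the leading $p\times p$ submatrix of $\boldsymbol\Sigma$. Write $$\boldsymbol\Sigma_{p+1}=\begin{pmatrix}\boldsymbol\Sigma_p&\boldsymbol\phi_{p,p+1}\\\boldsymbol\phi_{p,p+1}^\top&\sigma_{p+1}^2\end{pmatrix},\qquad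 a_{p,p+1}=\sigma_{p+1}^2-\boldsymbol\phi_{p,p+1}^\top\boldsymbol\Sigma_p^{-1}\boldsymbol\phi_{p,p+1}.$$ The weighted least squares model of size $p$ minimizes $(\mathbf y-\mathbf X_p\mathbf b)^\top\mathbf W(\mathbf y-\mathbf X_p\mathbf b)$ over $\mathbf b\in\mathbb R^p$. Its classical and predictive model degrees of freedom are $$\mathrm{df}_{\rm F}(p)=\frac1{\bar w}\mathrm{tr}\big[(\mathbf X_p^\top\mathbf W\mathbf X_p)^{-1}\mathbf X_p^\top\mathbf W\mathbf T\mathbf W\mathbf X_p\big],$$ $$\mathrm{df}_{\rm R}(p)=\frac12\mathrm{df}_{\rm F}(p)+\frac n2\mathrm{tr}\big[(\mathbf X_p^\top\mathbf W\mathbf X_p)^{-1}\mathbf X_p^\top\mathbf W\mathbf T\mathbf W\mathbf X_p(\mathbf X_p^\top\mathbf W\mathbf X_p)^{-1}\boldsymbol\Sigma_p\big].$$ Notation: $\tilde{\mathbf X}_p=\mathbf W^{1/2}\mathbf X_p/\sqrt{\bar w}$, $\tilde{\mathbf x}_{(p+1)}=\mathbf W^{1/2}\mathbf x_{(p+1)}/\sqrt{\bar w}$, $\tilde{\mathbf H}=\tilde{\mathbf X}_p(\tilde{\mathbf X}_p^\top\tilde{\mathbf X}_p)^{-1}\tilde{\mathbf X}_p^\top$, $\tilde{\mathbf r}_{(p+1)}=(\mathbf I_n-\tilde{\mathbf H})\tilde{\mathbf x}_{(p+1)}$. $\|\cdot\|$ is the Euclidean norm; for a square (not necessarily symmetric)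 matrix $\mathbf A$, $\langle\mathbf a,\mathbf b\rangle_{\mathbf A}=\mathbf a^\top\mathbf A\mathbf b$ and $\|\mathbf a\|_{\mathbf A}^2=\mathbf a^\top\mathbf A\mathbf a$. *)

theory Defs
  imports "HOL-Probability.Probability"
    "Jordan_Normal_Form.DL_Rank"
    "Jordan_Normal_Form.Gauss_Jordan_Elimination"
begin

(* The size p of the fitted model varies inside one statement, so matrices are the
   carrier-based ones of Jordan_Normal_Form, with 0-based indices. *)
no_notation vec_nth (infixl "$" 90)
no_notation inner (infix "\<bullet>" 70)
hide_const (open) Finite_Cartesian_Product.mat Finite_Cartesian_Product.vec
  Finite_Cartesian_Product.row Finite_Cartesian_Product.column
  Finite_Cartesian_Product.transpose Determinants.det Determinants.trace

definition mtrace :: "real mat \<Rightarrow> real" where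
  "mtrace A = (\<Sum>i<dim_row A. A $$ (i, i))"

(* Unspecified for singular matrices. *)
definition minv :: "real mat \<Rightarrow> real mat" where
  "minv A = the (mat_inverse A)"

definition pos_def_mat :: "nat \<Rightarrow> real mat \<Rightarrow> bool" where
  "pos_def_mat n A \<longleftrightarrow> A \<in> carrier_mat n n \<and> A\<^sup>T = A \<and>
     (\<forall>v \<in> carrier_vec n. v \<noteq> 0\<^sub>v n \<longrightarrow> v \<bullet> (A *\<^sub>v v) > 0)"

definition eucl_norm :: "real vec \<Rightarrow> real" where
  "eucl_norm v = sqrt (v \<bullet> v)"

definition mat_ip :: "real mat \<Rightarrow> real vec \<Rightarrow> real vec \<Rightarrow> real" where
  "mat_ip A a b = a \<bullet> (A *\<^sub>v b)"

definition mat_sqnorm :: "real mat \<Rightarrow> real vec \<Rightarrow> real" where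
  "mat_sqnorm A a = a \<bullet> (A *\<^sub>v a)"

definition leading_cols :: "nat \<Rightarrow> real mat \<Rightarrow> real mat" where
  "leading_cols p A = Matrix.mat (dim_row A) p (\<lambda>(i, j). A $$ (i, j))"

definition leading_block :: "nat \<Rightarrow> real mat \<Rightarrow> real mat" where
  "leading_block p A = Matrix.mat p p (\<lambda>(i, j). A $$ (i, j))"

(* The Borel sigma-algebra of R^m, carried over to vectors of dimension m. *)
definition vec_borel :: "nat \<Rightarrow> real vec measure" where
  "vec_borel m = vimage_algebra (carrier_vec m) (\<lambda>v. \<lambda>i\<in>{..<m}. v $ i)
     (PiM {..<m} (\<lambda>_. borel))"

definition design_matrix ::
    "nat \<Rightarrow> nat \<Rightarrow> (nat \<Rightarrow> 's \<Rightarrow> real vec) \<Rightarrow> 's \<Rightarrow> real mat" where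
  "design_matrix n d x \<omega> = mat_of_rows d (map (\<lambda>i. x i \<omega>) [0..<n])"

(* The sigma-algebra generated by the n rows of the design matrix. *)
definition design_algebra ::
    "'s measure \<Rightarrow> nat \<Rightarrow> nat \<Rightarrow> (nat \<Rightarrow> 's \<Rightarrow> real vec) \<Rightarrow> 's measure" where
  "design_algebra P n d x =
     vimage_algebra (space P) (\<lambda>\<omega>. \<lambda>i\<in>{..<n}. x i \<omega>) (PiM {..<n} (\<lambda>_. vec_borel d))"

(* Var(y | F) = E((y - E(y|F)) (y - E(y|F))^T | F), entrywise.  The conditional expectation
   real_cond_exp is built from the positive and negative parts, so requiring this to equal a
   given matrix with positive diagonal needs no integrability of y: where a conditional second
   moment is infinite, the corresponding diagonal entry is 0. *)
definition cond_var ::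
    "'s measure \<Rightarrow> 's measure \<Rightarrow> nat \<Rightarrow> ('s \<Rightarrow> real vec) \<Rightarrow> 's \<Rightarrow> real mat" where
  "cond_var P F n y \<omega> = Matrix.mat n n (\<lambda>(i, j).
     real_cond_exp P F (\<lambda>\<omega>'.
       (y \<omega>' $ i - real_cond_exp P F (\<lambda>\<omega>''. y \<omega>'' $ i) \<omega>') *
       (y \<omega>' $ j - real_cond_exp P F (\<lambda>\<omega>''. y \<omega>'' $ j) \<omega>')) \<omega>)"

definition mean_weight :: "nat \<Rightarrow> (nat \<Rightarrow> real) \<Rightarrow> real" where
  "mean_weight n w = (\<Sum>i<n. w i) / real n"

(* E(w(z) z z^T) / wbar for z = xstar; the number wbar depends on the realised design and is held fixed. *)
definition Sigma_mat ::
    "'s measure \<Rightarrow> nat \<Rightarrow> (real vec \<Rightarrow> real) \<Rightarrow> ('s \<Rightarrow> real vec) \<Rightarrow> real \<Rightarrow> real mat" where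
  "Sigma_mat P d w xstar wbar = (1 / wbar) \<cdot>\<^sub>m
     Matrix.mat d d (\<lambda>(j, k). \<integral>\<omega>. w (xstar \<omega>) * (xstar \<omega> $ j * xstar \<omega> $ k) \<partial>P)"

(* In the next two definitions X is the full design matrix, w and tau list the diagonals of
   W and T, and S is the full matrix Sigma. *)
definition df_F :: "(nat \<Rightarrow> real) \<Rightarrow> (nat \<Rightarrow> real) \<Rightarrow> real mat \<Rightarrow> nat \<Rightarrow> real" where
  "df_F w \<tau> X p = (let n = dim_row X; W = mat_diag n w; T = mat_diag n \<tau>;
       Xp = leading_cols p X
     in 1 / mean_weight n w * mtrace (minv (Xp\<^sup>T * W * Xp) * (Xp\<^sup>T * W * T * W * Xp)))"

definition df_R ::
    "(nat \<Rightarrow> real) \<Rightarrow> (nat \<Rightarrow> real) \<Rightarrow> real mat \<Rightarrow> real mat \<Rightarrow> nat \<Rightarrow> real" where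
  "df_R w \<tau> S X p = (let n = dim_row X; W = mat_diag n w; T = mat_diag n \<tau>;
       Xp = leading_cols p X
     in 1 / 2 * df_F w \<tau> X p + real n / 2 *
        mtrace (minv (Xp\<^sup>T * W * Xp) * (Xp\<^sup>T * W * T * W * Xp) * minv (Xp\<^sup>T * W * Xp)
                * leading_block p S))"

end

theory Submission
  imports Defs
begin

text \<open>Up to scaling, everything is expressed by the weighted design \<open>Z\<close> of size \<open>p + 1\<close>, whose first
  \<open>p\<close> columns form \<open>Y\<close> and whose last column is \<open>z\<close>: \<open>df\<^sub>F = tr (G\<^sup>-\<^sup>1 Z\<^sup>T U Z)\<close> with \<open>G = Z\<^sup>T Z\<close>, and the second
  trace of \<open>df\<^sub>R\<close> is \<open>tr (G\<^sup>-\<^sup>1 Z\<^sup>T U Z G\<^sup>-\<^sup>1 \<Sigma>)\<close>. Let \<open>r\<close> be the residual of \<open>z\<close> after regression on \<open>Y\<close>, with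
  coefficients \<open>b\<close>, and let \<open>v = (b, -1)\<close>, so that \<open>Z v = -r\<close>. Then \<open>G\<^sup>-\<^sup>1\<close> is the zero-padded inverse of
  \<open>Y\<^sup>T Y\<close> plus \<open>v v\<^sup>T / \<parallel>r\<parallel>\<^sup>2\<close>. Expanding the traces leaves, besides the terms of size \<open>p\<close>, only the
  quadratic forms \<open>r\<^sup>T U r\<close> and \<open>v\<^sup>T \<Sigma> v\<close> and one cross term. With \<open>c = \<Sigma>\<^sub>p\<^sup>-\<^sup>1 \<phi>\<close> and \<open>e = z - Y c\<close>, the
  identity \<open>b - c = (Y\<^sup>T Y)\<^sup>-\<^sup>1 Y\<^sup>T e\<close> turns the last two into the expressions in \<open>M\<close>.\<close>

section \<open>Matrix algebra\<close>

text \<open>The library states these laws with carrier sets, whose dimensions occur only in the premises;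
  the versions below have no such extra variables and can be used as rewrite rules.\<close>

lemma assoc_mult_mat_dim:
  fixes A B C :: "'a :: semiring_0 mat"
  assumes "dim_col A = dim_row B" "dim_col B = dim_row C"
  shows "A * B * C = A * (B * C)"
  using assms by (intro assoc_mult_mat[of A "dim_row A" "dim_col A" B "dim_col B" C "dim_col C"]) auto

lemma assoc_mult_mat_vec_dim:
  fixes A B :: "'a :: comm_ring_1 mat"
  assumes "dim_col A = dim_row B" "dim_col B = dim_vec v"
  shows "A * B *\<^sub>v v = A *\<^sub>v (B *\<^sub>v v)"
  using assms by (intro assoc_mult_mat_vec[of A "dim_row A" "dim_col A" B "dim_col B"]) auto

lemma scalar_prod_comm_dim:
  fixes u v :: "'a :: comm_semiring_0 vec"
  assumes "dim_vec u = dim_vec v"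
  shows "u \<bullet> v = v \<bullet> u"
  using assms by (intro comm_scalar_prod[of u "dim_vec u"]) (auto intro: carrier_vecI)

lemma scalar_prod_mult_mat_vec_dim:
  fixes A :: "'a :: comm_ring_1 mat"
  assumes "dim_vec u = dim_row A" "dim_vec v = dim_col A"
  shows "u \<bullet> (A *\<^sub>v v) = (A\<^sup>T *\<^sub>v u) \<bullet> v"
  using assms
  by (intro transpose_vec_mult_scalar[of A "dim_row A" "dim_col A", symmetric])
    (auto intro: carrier_vecI)

lemma transpose_mult_dim:
  fixes A B :: "'a :: comm_semiring_0 mat"
  assumes "dim_col A = dim_row B"
  shows "(A * B)\<^sup>T = B\<^sup>T * A\<^sup>T"
  using assms by (intro transpose_mult[of A "dim_row A" "dim_col A" B "dim_col B"]) auto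

lemma mult_minus_mat_vec_dim:
  fixes A :: "'a :: ring mat"
  assumes "dim_col A = dim_vec u" "dim_vec u = dim_vec v"
  shows "A *\<^sub>v (u - v) = A *\<^sub>v u - A *\<^sub>v v"
proof -
  have 1: "A \<in> carrier_mat (dim_row A) (dim_col A)" by (rule carrier_matI) (rule refl)+
  have 2: "u \<in> carrier_vec (dim_col A)" by (rule carrier_vecI) (rule assms(1)[symmetric])
  have 3: "v \<in> carrier_vec (dim_col A)" by (rule carrier_vecI) (simp only: assms)
  show ?thesis by (rule mult_minus_distrib_mat_vec[OF 1 2 3])
qed

lemma mult_uminus_mat_vec_dim:
  fixes A :: "real mat"
  assumes "dim_col A = dim_vec v"
  shows "A *\<^sub>v (- v) = - (A *\<^sub>v v)"
  using assms by (intro eq_vecI) (auto simp: scalar_prod_def sum_negf)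

lemma add_mult_mat_dim:
  fixes A B C :: "'a :: semiring_0 mat"
  assumes "dim_row A = dim_row B" "dim_col A = dim_col B" "dim_col A = dim_row C"
  shows "(A + B) * C = A * C + B * C"
  using assms by (intro add_mult_distrib_mat[of A "dim_row A" "dim_col A" B C "dim_col C"]) auto

lemma mult_add_mat_dim:
  fixes A B C :: "'a :: semiring_0 mat"
  assumes "dim_row B = dim_row C" "dim_col B = dim_col C" "dim_col A = dim_row B"
  shows "A * (B + C) = A * B + A * C"
  using assms by (intro mult_add_distrib_mat[of A "dim_row A" "dim_col A" B "dim_col B"]) auto

lemma smult_mult_mat_dim:
  fixes A B :: "'a :: comm_semiring_0 mat"
  assumes "dim_col A = dim_row B"
  shows "(k \<cdot>\<^sub>m A) * B = k \<cdot>\<^sub>m (A * B)"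
  using assms by (intro mult_smult_assoc_mat[of A "dim_row A" "dim_col A" B "dim_col B"]) auto

lemma mult_smult_mat_dim:
  fixes A B :: "'a :: comm_semiring_0 mat"
  assumes "dim_col A = dim_row B"
  shows "A * (k \<cdot>\<^sub>m B) = k \<cdot>\<^sub>m (A * B)"
  using assms by (intro mult_smult_distrib[of A "dim_row A" "dim_col A" B "dim_col B"]) auto

lemma smult_mult_mat_vec_dim:
  fixes A :: "real mat"
  assumes "dim_col A = dim_vec v"
  shows "(k \<cdot>\<^sub>m A) *\<^sub>v v = k \<cdot>\<^sub>v (A *\<^sub>v v)"
  using assms by (intro eq_vecI) (auto simp: scalar_prod_def sum_distrib_left ac_simps)

lemma add_mult_mat_vec_dim:
  fixes A B :: "real mat"
  assumes "dim_row A = dim_row B" "dim_col A = dim_col B" "dim_col A = dim_vec v"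
  shows "(A + B) *\<^sub>v v = A *\<^sub>v v + B *\<^sub>v v"
  using assms by (intro eq_vecI) (auto simp: scalar_prod_def sum.distrib algebra_simps)

lemma minus_mult_mat_vec_dim:
  fixes A B :: "real mat"
  assumes "dim_row A = dim_row B" "dim_col A = dim_col B" "dim_col A = dim_vec v"
  shows "(A - B) *\<^sub>v v = A *\<^sub>v v - B *\<^sub>v v"
  using assms by (intro eq_vecI) (auto simp: scalar_prod_def sum_subtractf algebra_simps)

lemma scalar_prod_minus_dim:
  fixes u v w :: "real vec"
  assumes "dim_vec u = dim_vec v" "dim_vec v = dim_vec w"
  shows "u \<bullet> (v - w) = u \<bullet> v - u \<bullet> w" "(v - w) \<bullet> u = v \<bullet> u - w \<bullet> u"
  using assms by (simp_all add: scalar_prod_def sum_subtractf algebra_simps)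

lemma scalar_prod_uminus_dim:
  fixes u v :: "real vec"
  assumes "dim_vec u = dim_vec v"
  shows "u \<bullet> (- v) = - (u \<bullet> v)" "(- u) \<bullet> v = - (u \<bullet> v)"
  using assms by (simp_all add: scalar_prod_def sum_negf)

lemma smult_smult_mat: "k \<cdot>\<^sub>m (l \<cdot>\<^sub>m A) = (k * l) \<cdot>\<^sub>m (A :: 'a :: semigroup_mult mat)"
  by (intro eq_matI) (auto simp: mult.assoc)

lemma transpose_smult: "(k \<cdot>\<^sub>m A)\<^sup>T = k \<cdot>\<^sub>m A\<^sup>T"
  by (intro eq_matI) auto

lemma transpose_mat_diag: "(mat_diag n f)\<^sup>T = mat_diag n f"
  by (intro eq_matI) (auto simp: mat_diag_def)

lemma dim_mat_diag [simp]: "dim_row (mat_diag n f) = n" "dim_col (mat_diag n f) = n"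
  by (auto simp: mat_diag_def)

lemma mult_mat_vec_unit:
  fixes A :: "'a :: semiring_1 mat"
  assumes "i < dim_col A"
  shows "A *\<^sub>v unit_vec (dim_col A) i = Matrix.col A i"
  using assms by (intro eq_vecI) auto

section \<open>Traces and rank-one matrices\<close>

lemma mtrace_add:
  assumes "dim_row A = dim_row B"
  shows "dim_col A = dim_row A \<Longrightarrow> dim_col B = dim_row B \<Longrightarrow> mtrace (A + B) = mtrace A + mtrace B"
  using assms by (simp add: mtrace_def sum.distrib)

lemma mtrace_smult: "dim_row A = dim_col A \<Longrightarrow> mtrace (k \<cdot>\<^sub>m A) = k * mtrace A"
  by (simp add: mtrace_def sum_distrib_left)

lemma mtrace_mult_commute:
  assumes "dim_col A = dim_row B" "dim_col B = dim_row A"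
  shows "mtrace (A * B) = mtrace (B * A)"
proof -
  have "mtrace (A * B) = (\<Sum>i<dim_row A. \<Sum>k<dim_row B. A $$ (i, k) * B $$ (k, i))"
    using assms by (simp add: mtrace_def scalar_prod_def atLeast0LessThan)
  also have "\<dots> = (\<Sum>k<dim_row B. \<Sum>i<dim_row A. A $$ (i, k) * B $$ (k, i))"
    by (rule sum.swap)
  also have "\<dots> = mtrace (B * A)"
    using assms by (simp add: mtrace_def scalar_prod_def atLeast0LessThan mult.commute)
  finally show ?thesis .
qed

definition outer :: "real vec \<Rightarrow> real vec \<Rightarrow> real mat" where
  "outer u v = Matrix.mat (dim_vec u) (dim_vec v) (\<lambda>(i, j). u $ i * v $ j)"

lemma dim_outer [simp]: "dim_row (outer u v) = dim_vec u" "dim_col (outer u v) = dim_vec v"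
  by (simp_all add: outer_def)

lemma mult_outer:
  assumes "dim_col A = dim_vec u"
  shows "A * outer u v = outer (A *\<^sub>v u) v"
  using assms by (intro eq_matI) (auto simp: outer_def scalar_prod_def sum_distrib_right mult.assoc)

lemma outer_mult:
  assumes "dim_vec v = dim_row A"
  shows "outer u v * A = outer u (A\<^sup>T *\<^sub>v v)"
  using assms by (intro eq_matI)
    (auto simp: outer_def scalar_prod_def sum_distrib_left ac_simps)

lemma outer_mult_vec:
  assumes "dim_vec v = dim_vec w"
  shows "outer u v *\<^sub>v w = (v \<bullet> w) \<cdot>\<^sub>v u"
  using assms by (intro eq_vecI)
    (auto simp: outer_def scalar_prod_def sum_distrib_left ac_simps)

lemma mtrace_outer: "dim_vec u = dim_vec v \<Longrightarrow> mtrace (outer u v) = u \<bullet> v"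
  by (simp add: mtrace_def outer_def scalar_prod_def atLeast0LessThan)

section \<open>Injective matrices and inverses\<close>

text \<open>Injectivity serves as the one nondegeneracy notion throughout: for rectangular matrices
  it is full column rank, for square ones invertibility, and it passes to products, which rank
  arguments would make laborious.\<close>

definition trivial_kernel :: "real mat \<Rightarrow> bool" where
  "trivial_kernel A \<longleftrightarrow>
     (\<forall>v. dim_vec v = dim_col A \<longrightarrow> A *\<^sub>v v = 0\<^sub>v (dim_row A) \<longrightarrow> v = 0\<^sub>v (dim_col A))"

lemma trivial_kernelD:
  "trivial_kernel A \<Longrightarrow> dim_vec v = dim_col A \<Longrightarrow> A *\<^sub>v v = 0\<^sub>v (dim_row A) \<Longrightarrow> v = 0\<^sub>v (dim_col A)"
  by (simp add: trivial_kernel_def)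

lemma trivial_kernel_mult:
  assumes "trivial_kernel A" "trivial_kernel B" "dim_col A = dim_row B"
  shows "trivial_kernel (A * B)"
  using assms unfolding trivial_kernel_def by (auto simp: assoc_mult_mat_vec_dim)

lemma trivial_kernel_smult:
  assumes "trivial_kernel A" "k \<noteq> 0"
  shows "trivial_kernel (k \<cdot>\<^sub>m A)"
  unfolding trivial_kernel_def
proof (intro allI impI)
  fix v assume v: "dim_vec v = dim_col (k \<cdot>\<^sub>m A)" "(k \<cdot>\<^sub>m A) *\<^sub>v v = 0\<^sub>v (dim_row (k \<cdot>\<^sub>m A))"
  have "A *\<^sub>v v = 0\<^sub>v (dim_row A)"
  proof (rule eq_vecI)
    fix i assume "i < dim_vec (0\<^sub>v (dim_row A) :: real vec)"
    then show "(A *\<^sub>v v) $ i = 0\<^sub>v (dim_row A) $ i"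
      using arg_cong[OF v(2), of "\<lambda>u. u $ i"] v(1) assms(2) by simp
  qed simp
  then show "v = 0\<^sub>v (dim_col (k \<cdot>\<^sub>m A))"
    using trivial_kernelD[OF assms(1)] v(1) by simp
qed

lemma trivial_kernel_mat_diag:
  assumes "\<And>i. i < n \<Longrightarrow> f i \<noteq> 0"
  shows "trivial_kernel (mat_diag n f)"
  unfolding trivial_kernel_def
proof (intro allI impI)
  fix v assume v: "dim_vec v = dim_col (mat_diag n f)" "mat_diag n f *\<^sub>v v = 0\<^sub>v (dim_row (mat_diag n f))"
  show "v = 0\<^sub>v (dim_col (mat_diag n f))"
  proof (rule eq_vecI)
    fix i assume i: "i < dim_vec (0\<^sub>v (dim_col (mat_diag n f)) :: real vec)"
    have "(mat_diag n f *\<^sub>v v) $ i = f i * v $ i"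
      using i v(1) by (simp add: mat_diag_def scalar_prod_def if_distrib[of "\<lambda>x. x * _"] cong: if_cong)
    then show "v $ i = 0\<^sub>v (dim_col (mat_diag n f)) $ i"
      using i v assms by simp
  qed (use v in simp)
qed

text \<open>The first \<open>q\<close> columns of the identity form the map that appends zeros to a
  vector, so the first \<open>q\<close> entries of the image give the vector back. Later this matrix
  selects leading columns and blocks.\<close>

lemma trivial_kernel_leading_cols_one:
  assumes "q \<le> m"
  shows "trivial_kernel (leading_cols q (1\<^sub>m m))"
  unfolding trivial_kernel_def
proof (intro allI impI)
  let ?E = "leading_cols q (1\<^sub>m m)"
  fix v assume v: "dim_vec v = dim_col ?E" "?E *\<^sub>v v = 0\<^sub>v (dim_row ?E)"
  show "v = 0\<^sub>v (dim_col ?E)"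
  proof (rule eq_vecI)
    fix i assume i: "i < dim_vec (0\<^sub>v (dim_col ?E) :: real vec)"
    have "(?E *\<^sub>v v) $ i = v $ i"
      using i v(1) assms
      by (simp add: leading_cols_def scalar_prod_def if_distrib[of "\<lambda>x. x * _"] cong: if_cong)
    then show "v $ i = 0\<^sub>v (dim_col ?E) $ i"
      using i v assms by (simp add: leading_cols_def)
  qed (use v in simp)
qed

text \<open>Pairing \<open>A\<^sup>T S A v\<close> with \<open>v\<close> gives the quadratic form of
  \<open>S\<close> at \<open>A v\<close>, which vanishes only for \<open>A v = 0\<close>. Taking
  \<open>S\<close> as the identity covers Gram matrices; taking \<open>A\<close> as a selection of
  coordinates covers leading blocks.\<close>

lemma trivial_kernel_congruence:
  assumes S: "pos_def_mat n S" and A: "trivial_kernel A" "dim_row A = n"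
  shows "trivial_kernel (A\<^sup>T * S * A)"
  unfolding trivial_kernel_def
proof (intro allI impI)
  fix v assume v: "dim_vec v = dim_col (A\<^sup>T * S * A)"
    "A\<^sup>T * S * A *\<^sub>v v = 0\<^sub>v (dim_row (A\<^sup>T * S * A))"
  have dims: "dim_row S = n" "dim_col S = n"
    using S by (auto simp: pos_def_mat_def)
  have "(A *\<^sub>v v) \<bullet> (S *\<^sub>v (A *\<^sub>v v)) = v \<bullet> (A\<^sup>T *\<^sub>v (S *\<^sub>v (A *\<^sub>v v)))"
    using v A dims by (subst scalar_prod_mult_mat_vec_dim[of v "A\<^sup>T"]) auto
  also have "A\<^sup>T *\<^sub>v (S *\<^sub>v (A *\<^sub>v v)) = 0\<^sub>v (dim_col A)"
    using v A dims by (simp add: assoc_mult_mat_vec_dim)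
  finally have "\<not> (A *\<^sub>v v) \<bullet> (S *\<^sub>v (A *\<^sub>v v)) > 0"
    using v by (simp add: scalar_prod_def)
  moreover have "A *\<^sub>v v \<in> carrier_vec n"
    using A by (auto intro: carrier_vecI)
  ultimately have "A *\<^sub>v v = 0\<^sub>v n"
    using S by (auto simp: pos_def_mat_def)
  then show "v = 0\<^sub>v (dim_col (A\<^sup>T * S * A))"
    using trivial_kernelD[OF A(1)] v A(2) by simp
qed

lemma pos_def_one: "pos_def_mat n (1\<^sub>m n)"
  unfolding pos_def_mat_def
proof (intro conjI ballI impI)
  fix v :: "real vec" assume v: "v \<in> carrier_vec n" "v \<noteq> 0\<^sub>v n"
  then show "v \<bullet> (1\<^sub>m n *\<^sub>v v) > 0"
    using conjugate_square_greater_0_vec[of v n] by (simp add: scalar_prod_def)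
qed auto

lemma trivial_kernel_gram: "trivial_kernel A \<Longrightarrow> trivial_kernel (A\<^sup>T * A)"
  using trivial_kernel_congruence[OF pos_def_one, of A "dim_row A"]
  by (metis index_transpose_mat(3) right_mult_one_mat')

text \<open>Independence of the columns as a set does not see a column that occurs twice, so
  repetitions are excluded first: the rank is the size of a maximal independent set of columns,
  hence below \<open>k\<close> if fewer than \<open>k\<close> of them are distinct.\<close>

lemma trivial_kernel_full_rank:
  assumes A: "A \<in> carrier_mat n k" and rank: "vec_space.rank n A = k"
  shows "trivial_kernel A"
proof -
  interpret vec_space "TYPE(real)" n .
  have dist: "distinct (cols A)"
  proof (rule ccontr)
    assume "\<not> distinct (cols A)"
    then have "card (set (cols A)) < k"
      using A card_distinct[of "cols A"] card_length[of "cols A"] by (auto simp: le_less)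
    moreover obtain S where S: "maximal S (\<lambda>T. T \<subseteq> set (cols A) \<and> lin_indpt T)"
      using maximal_exists_superset[of "set (cols A)" "\<lambda>T. T \<subseteq> set (cols A) \<and> lin_indpt T" "{}"]
        finite_lin_indpt2[of "{}"] by auto
    moreover have "card S \<le> card (set (cols A))"
      using S by (simp add: card_mono maximal_def)
    ultimately show False
      using rank_card_indpt[OF A S] rank by simp
  qed
  then have "lin_indpt (set (cols A))"
    using full_rank_lin_indpt[OF A] rank by simp
  then show ?thesis
    using lin_depI[OF A] dist A unfolding trivial_kernel_def by (auto intro: carrier_vecI)
qed

text \<open>A trivial kernel makes the determinant nonzero and the matrix a unit, so
  \<open>mat_inverse\<close> returns a result and \<open>minv\<close> is a genuine two-sided
  inverse.\<close>

lemma minv_trivial_kernel: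
  assumes "A \<in> carrier_mat n n" "trivial_kernel A"
  shows "minv A \<in> carrier_mat n n" "A * minv A = 1\<^sub>m n" "minv A * A = 1\<^sub>m n"
proof -
  have "det A \<noteq> 0"
    using assms det_0_iff_vec_prod_zero[OF assms(1)] by (auto simp: trivial_kernel_def)
  then have "A \<in> Units (ring_mat TYPE(real) n ())"
    using det_non_zero_imp_unit[OF assms(1)] by simp
  then obtain B where "mat_inverse A = Some B"
    using mat_inverse(1)[OF assms(1), of "()"] by (cases "mat_inverse A") auto
  with mat_inverse(2)[OF assms(1) this]
  show "minv A \<in> carrier_mat n n" "A * minv A = 1\<^sub>m n" "minv A * A = 1\<^sub>m n"
    by (auto simp: minv_def)
qed

text \<open>A left inverse is enough: it forces the kernel to be trivial, so \<open>minv A\<close>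
  inverts \<open>A\<close> on both sides, and \<open>B = B A (minv A)\<close> identifies the
  two.\<close>

lemma minv_eqI:
  assumes A: "A \<in> carrier_mat n n" and B: "B \<in> carrier_mat n n" and BA: "B * A = 1\<^sub>m n"
  shows "minv A = B"
proof -
  have "trivial_kernel A"
    unfolding trivial_kernel_def
  proof (intro allI impI)
    fix v assume v: "dim_vec v = dim_col A" "A *\<^sub>v v = 0\<^sub>v (dim_row A)"
    have "v \<in> carrier_vec n"
      using v(1) A by (auto intro: carrier_vecI)
    then have "v = B * A *\<^sub>v v"
      unfolding BA by (rule one_mult_mat_vec[symmetric])
    also have "\<dots> = B *\<^sub>v (A *\<^sub>v v)"
      using A B v by (intro assoc_mult_mat_vec_dim) auto
    also have "\<dots> = 0\<^sub>v n"
      using A B v by auto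
    finally show "v = 0\<^sub>v (dim_col A)"
      using A by simp
  qed
  note m = minv_trivial_kernel[OF A this]
  have "B = B * (A * minv A)"
    using B m by simp
  also have "\<dots> = B * A * minv A"
    using A B m by (subst assoc_mult_mat_dim) auto
  also have "\<dots> = minv A"
    using BA m by simp
  finally show ?thesis ..
qed

text \<open>Transposing \<open>G (minv G) = 1\<close> for the symmetric Gram matrix \<open>G\<close>
  shows that the transposed inverse is again a left inverse.\<close>

lemma transpose_minv_gram:
  assumes "trivial_kernel A"
  shows "(minv (A\<^sup>T * A))\<^sup>T = minv (A\<^sup>T * A)"
proof -
  let ?G = "A\<^sup>T * A"
  have G: "?G \<in> carrier_mat (dim_col A) (dim_col A)" by auto
  note m = minv_trivial_kernel[OF G trivial_kernel_gram[OF assms]]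
  have GT: "?G\<^sup>T = ?G"
    by (simp add: transpose_mult_dim)
  have "(minv ?G)\<^sup>T * ?G = (?G * minv ?G)\<^sup>T"
    using m by (subst transpose_mult_dim[of ?G]) (auto simp: GT)
  also have "\<dots> = 1\<^sub>m (dim_col A)"
    using m by simp
  finally show ?thesis
    using m by (intro minv_eqI[symmetric, OF G]) auto
qed

lemma minv_smult:
  assumes A: "A \<in> carrier_mat n n" "trivial_kernel A" and k: "k \<noteq> 0"
  shows "minv (k \<cdot>\<^sub>m A) = (1 / k) \<cdot>\<^sub>m minv A"
proof (rule minv_eqI)
  note m = minv_trivial_kernel[OF A]
  show "k \<cdot>\<^sub>m A \<in> carrier_mat n n" "(1 / k) \<cdot>\<^sub>m minv A \<in> carrier_mat n n"
    using A m by auto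
  have "dim_col (minv A) = dim_row A"
    using A m by auto
  then have "((1 / k) \<cdot>\<^sub>m minv A) * (k \<cdot>\<^sub>m A) = (k * (1 / k)) \<cdot>\<^sub>m (minv A * A)"
    by (simp only: smult_mult_mat_dim mult_smult_mat_dim index_smult_mat smult_smult_mat)
  then show "((1 / k) \<cdot>\<^sub>m minv A) * (k \<cdot>\<^sub>m A) = 1\<^sub>m n"
    using k m by (auto intro!: eq_matI)
qed

section \<open>Leading columns and blocks as products with a selection matrix\<close>

lemma dim_leading_cols [simp]:
  "dim_row (leading_cols q A) = dim_row A" "dim_col (leading_cols q A) = q"
  by (simp_all add: leading_cols_def)

lemma dim_leading_block [simp]:
  "dim_row (leading_block q A) = q" "dim_col (leading_block q A) = q"
  by (simp_all add: leading_block_def)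

lemma index_leading_cols [simp]:
  "i < dim_row A \<Longrightarrow> j < q \<Longrightarrow> leading_cols q A $$ (i, j) = A $$ (i, j)"
  by (simp add: leading_cols_def)

lemma col_leading_cols [simp]:
  "j < q \<Longrightarrow> q \<le> dim_col A \<Longrightarrow> Matrix.col (leading_cols q A) j = Matrix.col A j"
  by (intro eq_vecI) auto

lemma leading_cols_mult:
  "q \<le> dim_col B \<Longrightarrow> A * leading_cols q B = leading_cols q (A * B)"
  by (intro eq_matI) auto

lemma leading_cols_eq_mult:
  "q \<le> dim_col A \<Longrightarrow> leading_cols q A = A * leading_cols q (1\<^sub>m (dim_col A))"
  by (simp add: leading_cols_mult)

text \<open>Writing the block as a congruence lets symmetry and invertibility descend from
  \<open>S\<close> by pure algebra, without index computations.\<close>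

lemma leading_block_eq_mult:
  assumes "dim_row S = m" "dim_col S = m" "q \<le> m"
  shows "leading_block q S = (leading_cols q (1\<^sub>m m))\<^sup>T * S * leading_cols q (1\<^sub>m m)"
proof (rule eq_matI)
  let ?E = "leading_cols q (1\<^sub>m m) :: real mat"
  fix i j assume "i < dim_row (?E\<^sup>T * S * ?E)" "j < dim_col (?E\<^sup>T * S * ?E)"
  then have ij: "i < q" "j < q" by auto
  have "Matrix.col ?E i = unit_vec m i"
    using ij assms by (auto intro!: eq_vecI simp: unit_vec_def)
  then have "(?E\<^sup>T * (S * ?E)) $$ (i, j) = (S * ?E) $$ (i, j)"
    using ij assms by (simp add: carrier_vecI)
  also have "(S * ?E) $$ (i, j) = leading_cols q S $$ (i, j)"
    using assms leading_cols_eq_mult[of q S] by simp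
  also have "leading_cols q S $$ (i, j) = leading_block q S $$ (i, j)"
    using ij assms by (simp add: leading_block_def)
  finally show "leading_block q S $$ (i, j) = (?E\<^sup>T * S * ?E) $$ (i, j)"
    using assms by (simp only: assoc_mult_mat_dim dim_leading_cols index_transpose_mat index_one_mat)
qed (use assms in auto)

lemma trivial_kernel_leading_cols:
  "trivial_kernel A \<Longrightarrow> q \<le> dim_col A \<Longrightarrow> trivial_kernel (leading_cols q A)"
  using trivial_kernel_mult[OF _ trivial_kernel_leading_cols_one, of A q "dim_col A"]
  by (simp add: leading_cols_eq_mult[of q A])

lemma trivial_kernel_leading_block:
  assumes "pos_def_mat m S" "q \<le> m"
  shows "trivial_kernel (leading_block q S)"
  using trivial_kernel_congruence[OF assms(1) trivial_kernel_leading_cols_one[OF assms(2)]] assms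
  by (subst leading_block_eq_mult[of S m]) (auto simp: pos_def_mat_def)

text \<open>The columns are tested in two groups, the first \<open>p\<close> together and the last
  one alone, to match the division of a bordered matrix into its old columns and the new
  one.\<close>

lemma eq_one_matI:
  assumes A: "A \<in> carrier_mat (Suc p) (Suc p)"
    and "leading_cols p A = leading_cols p (1\<^sub>m (Suc p))"
    and "A *\<^sub>v unit_vec (Suc p) p = unit_vec (Suc p) p"
  shows "A = 1\<^sub>m (Suc p)"
proof (rule eq_matI)
  fix i j assume "i < dim_row (1\<^sub>m (Suc p) :: real mat)" "j < dim_col (1\<^sub>m (Suc p) :: real mat)"
  then have i: "i < Suc p" and j: "j < p \<or> j = p" by auto
  show "A $$ (i, j) = 1\<^sub>m (Suc p) $$ (i, j)"
  proof (cases "j < p")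
    case True
    then show ?thesis
      using arg_cong[OF assms(2), of "\<lambda>B. B $$ (i, j)"] i A by simp
  next
    case False
    then have "j = p" using j by simp
    moreover have "Matrix.col A p = unit_vec (Suc p) p"
      using mult_mat_vec_unit[of p A] assms(3) A by simp
    then have "Matrix.col A p $ i = unit_vec (Suc p) p $ i"
      by simp
    ultimately show ?thesis
      using i A by auto
  qed
qed (use A in auto)

section \<open>Bordering a matrix by one column\<close>

locale bordered_matrix =
  fixes Z :: "real mat" and p :: nat
  assumes dim_col_Z: "dim_col Z = Suc p" and trivial_kernel_Z: "trivial_kernel Z"
begin

text \<open>\<open>E\<close> appends a zero to a vector of length \<open>p\<close>, so
  \<open>E * N * E\<^sup>T\<close> is \<open>N\<close> padded by a zero row and column;
  \<open>u\<close> selects the last coordinate. \<open>N\<close> is the inverse Gram matrix of the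
  old columns.\<close>

definition E :: "real mat" where "E = leading_cols p (1\<^sub>m (Suc p))"
definition u :: "real vec" where "u = unit_vec (Suc p) p"
definition Y :: "real mat" where "Y = leading_cols p Z"
definition z :: "real vec" where "z = Matrix.col Z p"
definition N :: "real mat" where "N = minv (Y\<^sup>T * Y)"
definition b :: "real vec" where "b = N *\<^sub>v (Y\<^sup>T *\<^sub>v z)"
definition r :: "real vec" where "r = z - Y *\<^sub>v b"
definition v :: "real vec" where "v = E *\<^sub>v b - u"

lemma trivial_kernel_Y: "trivial_kernel Y"
  unfolding Y_def using trivial_kernel_Z dim_col_Z by (intro trivial_kernel_leading_cols) auto

lemma dims [simp]:
  "dim_row E = Suc p" "dim_col E = p" "dim_vec u = Suc p"
  "dim_row Y = dim_row Z" "dim_col Y = p" "dim_vec z = dim_row Z"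
  by (simp_all add: E_def u_def Y_def z_def)

lemma gram_carrier: "Y\<^sup>T * Y \<in> carrier_mat p p"
  by (rule carrier_matI) simp_all

lemmas N = minv_trivial_kernel[OF gram_carrier trivial_kernel_gram[OF trivial_kernel_Y], folded N_def]

lemma dims_N [simp]: "dim_row N = p" "dim_col N = p"
  using N(1) by auto

lemma dims_vec [simp]: "dim_vec b = p" "dim_vec r = dim_row Z" "dim_vec v = Suc p"
  by (simp_all add: b_def r_def v_def)

lemma transpose_N: "N\<^sup>T = N"
  unfolding N_def by (rule transpose_minv_gram[OF trivial_kernel_Y])

lemma Z_mult_E: "Z * E = Y"
  using leading_cols_eq_mult[of p Z] dim_col_Z by (simp add: E_def Y_def)

lemma Z_mult_u: "Z *\<^sub>v u = z"
  using mult_mat_vec_unit[of p Z] dim_col_Z by (simp add: u_def z_def)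

lemma Z_mult_v: "Z *\<^sub>v v = - r"
proof -
  have "Z *\<^sub>v v = Z * E *\<^sub>v b - Z *\<^sub>v u"
    using dim_col_Z by (simp add: v_def mult_minus_mat_vec_dim assoc_mult_mat_vec_dim)
  then show ?thesis
    by (auto simp: Z_mult_E Z_mult_u r_def intro!: eq_vecI)
qed

text \<open>These are the normal equations, from \<open>Y\<^sup>T Y N = 1\<close>.\<close>

lemma Y_transpose_r: "Y\<^sup>T *\<^sub>v r = 0\<^sub>v p"
proof -
  have "Y\<^sup>T *\<^sub>v (Y *\<^sub>v b) = Y\<^sup>T * Y * N *\<^sub>v (Y\<^sup>T *\<^sub>v z)"
    by (simp add: b_def assoc_mult_mat_vec_dim)
  then show ?thesis
    using N(2) by (auto simp: r_def mult_minus_mat_vec_dim carrier_vecI intro!: eq_vecI)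
qed

text \<open>If \<open>r\<close> were zero, \<open>Z v = -r\<close> would put \<open>v\<close> in the
  kernel of \<open>Z\<close>, yet the last entry of \<open>v\<close> is -1 because
  \<open>E b\<close> ends in 0.\<close>

lemma r_sq_pos: "r \<bullet> r > 0"
proof -
  have "r \<noteq> 0\<^sub>v (dim_row Z)"
  proof
    assume "r = 0\<^sub>v (dim_row Z)"
    then have "v = 0\<^sub>v (Suc p)"
      using trivial_kernelD[OF trivial_kernel_Z, of v] dim_col_Z Z_mult_v by simp
    then have "v $ p = 0"
      by simp
    moreover have "v $ p = (E *\<^sub>v b) $ p - 1"
      by (simp add: v_def u_def)
    moreover have "Matrix.row E p = 0\<^sub>v p"
      by (auto simp: E_def intro!: eq_vecI)
    ultimately show False
      by (simp add: carrier_vecI)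
  qed
  then show ?thesis
    using conjugate_square_greater_0_vec[of r "dim_row Z"] by (simp add: carrier_vecI)
qed

text \<open>The fitted part \<open>Y b\<close> of \<open>z\<close> is orthogonal to
  \<open>r\<close>.\<close>

lemma r_dot_z: "r \<bullet> z = r \<bullet> r"
proof -
  have "r \<bullet> (Y *\<^sub>v b) = 0"
    by (simp add: scalar_prod_mult_mat_vec_dim Y_transpose_r carrier_vecI)
  then show ?thesis
    by (subst (3) r_def) (simp add: scalar_prod_minus_dim)
qed

text \<open>Bordering \<open>Y\<close> by the column \<open>z\<close> changes the inverse Gram matrix by a rank-one
  matrix, because \<open>v\<close> holds the coefficients of \<open>-r\<close> in the columns of \<open>Z\<close> and \<open>r\<close> is
  orthogonal to the columns of \<open>Y\<close>.\<close>

lemma minv_gram: "minv (Z\<^sup>T * Z) = E * N * E\<^sup>T + (1 / (r \<bullet> r)) \<cdot>\<^sub>m outer v v"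
proof (rule minv_eqI)
  let ?K = "E * N * E\<^sup>T + (1 / (r \<bullet> r)) \<cdot>\<^sub>m outer v v"
  show "Z\<^sup>T * Z \<in> carrier_mat (Suc p) (Suc p)" "?K \<in> carrier_mat (Suc p) (Suc p)"
    by (auto simp: dim_col_Z)
  \<comment> \<open>Because \<open>Z v = -r\<close>, the rank-one part sees \<open>A\<close> only
    through \<open>A\<^sup>T r\<close>. This vanishes for \<open>A = Y\<close>, which leaves the
    padded \<open>N\<close> to invert \<open>Y\<^sup>T Y\<close> on the first \<open>p\<close>
    columns.\<close>
  have vZ: "outer v v * (Z\<^sup>T * A) = - outer v (A\<^sup>T *\<^sub>v r)" if "dim_row A = dim_row Z" for A
  proof -
    have "outer v v * (Z\<^sup>T * A) = outer v (- (A\<^sup>T *\<^sub>v r))"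
      using that dim_col_Z
      by (simp add: outer_mult transpose_mult_dim assoc_mult_mat_vec_dim Z_mult_v
          mult_uminus_mat_vec_dim)
    then show ?thesis
      by (auto simp: outer_def)
  qed
  have K: "?K * (Z\<^sup>T * A) = E * (N * (Y\<^sup>T * A)) + (1 / (r \<bullet> r)) \<cdot>\<^sub>m (- outer v (A\<^sup>T *\<^sub>v r))"
    if "dim_row A = dim_row Z" for A
    using that dim_col_Z
    by (simp add: add_mult_mat_dim smult_mult_mat_dim vZ assoc_mult_mat_dim
        Z_mult_E[symmetric] transpose_mult_dim)
  show "?K * (Z\<^sup>T * Z) = 1\<^sub>m (Suc p)"
  proof (rule eq_one_matI)
    show "?K * (Z\<^sup>T * Z) \<in> carrier_mat (Suc p) (Suc p)"
      by (auto simp: dim_col_Z)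
    have "leading_cols p (?K * (Z\<^sup>T * Z)) = ?K * (Z\<^sup>T * Z) * E"
      using dim_col_Z leading_cols_eq_mult[of p "?K * (Z\<^sup>T * Z)"] by (simp add: E_def)
    also have "\<dots> = ?K * (Z\<^sup>T * Y)"
      using dim_col_Z by (simp add: Z_mult_E[symmetric] assoc_mult_mat_dim)
    also have "\<dots> = E * (N * (Y\<^sup>T * Y)) + (1 / (r \<bullet> r)) \<cdot>\<^sub>m (- outer v (0\<^sub>v p))"
      by (simp add: K Y_transpose_r)
    also have "\<dots> = E"
      by (auto simp: N(3) outer_def intro!: eq_matI)
    finally show "leading_cols p (?K * (Z\<^sup>T * Z)) = leading_cols p (1\<^sub>m (Suc p))"
      by (simp add: E_def)
    have "?K * (Z\<^sup>T * Z) *\<^sub>v u = ?K *\<^sub>v (Z\<^sup>T *\<^sub>v z)"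
      using dim_col_Z by (simp add: Z_mult_u[symmetric] assoc_mult_mat_vec_dim)
    also have "\<dots> = E *\<^sub>v (N *\<^sub>v ((Z * E)\<^sup>T *\<^sub>v z)) + (1 / (r \<bullet> r)) \<cdot>\<^sub>v ((v \<bullet> (Z\<^sup>T *\<^sub>v z)) \<cdot>\<^sub>v v)"
      using dim_col_Z
      by (simp add: add_mult_mat_vec_dim smult_mult_mat_vec_dim assoc_mult_mat_vec_dim
          outer_mult_vec transpose_mult_dim)
    \<comment> \<open>This value turns the rank-one contribution on the last column into
      \<open>-v\<close>, and \<open>E b - v = u\<close> by the choice of \<open>v\<close>.\<close>
    also have "v \<bullet> (Z\<^sup>T *\<^sub>v z) = - (r \<bullet> r)"
      using dim_col_Z
      by (simp add: scalar_prod_mult_mat_vec_dim Z_mult_v scalar_prod_uminus_dim r_dot_z)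
    also have "E *\<^sub>v (N *\<^sub>v ((Z * E)\<^sup>T *\<^sub>v z)) + (1 / (r \<bullet> r)) \<cdot>\<^sub>v (- (r \<bullet> r) \<cdot>\<^sub>v v) = u"
      using r_sq_pos unfolding Z_mult_E b_def[symmetric] by (auto simp: v_def intro!: eq_vecI)
    finally show "?K * (Z\<^sup>T * Z) *\<^sub>v unit_vec (Suc p) p = unit_vec (Suc p) p"
      by (simp add: u_def)
  qed
qed

section \<open>Increment of the trace in \<open>df_F\<close>\<close>

context
  fixes U :: "real mat"
  assumes dims_U [simp]: "dim_row U = dim_row Z" "dim_col U = dim_row Z" and U_sym: "U\<^sup>T = U"
begin

lemma quadratic_v: "v \<bullet> (Z\<^sup>T * U * Z *\<^sub>v v) = r \<bullet> (U *\<^sub>v r)"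
  using dim_col_Z
  by (simp add: assoc_mult_mat_vec_dim scalar_prod_mult_mat_vec_dim[of v "Z\<^sup>T"] Z_mult_v
      mult_uminus_mat_vec_dim scalar_prod_uminus_dim)

lemma E_form: "E\<^sup>T * (Z\<^sup>T * U * Z) * E = Y\<^sup>T * U * Y"
  using dim_col_Z by (simp add: Z_mult_E[symmetric] assoc_mult_mat_dim transpose_mult_dim)

lemma form_sym: "(Z\<^sup>T * U * Z)\<^sup>T = Z\<^sup>T * U * Z"
  by (simp add: assoc_mult_mat_dim transpose_mult_dim U_sym)

text \<open>In the padded part, cycling \<open>E\<close> to the end of the trace compresses the form
  to \<open>Y\<^sup>T U Y\<close>. The rank-one part contributes its quadratic form at
  \<open>v\<close>, that is, the one of \<open>U\<close> at \<open>r\<close>.\<close>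

lemma mtrace_increment:
  "mtrace (minv (Z\<^sup>T * Z) * (Z\<^sup>T * U * Z)) =
     mtrace (N * (Y\<^sup>T * U * Y)) + (r \<bullet> (U *\<^sub>v r)) / (r \<bullet> r)"
proof -
  let ?B = "Z\<^sup>T * U * Z"
  have "mtrace (E * N * E\<^sup>T * ?B) = mtrace (E * (N * E\<^sup>T * ?B))"
    using dim_col_Z by (simp add: assoc_mult_mat_dim)
  also have "\<dots> = mtrace (N * E\<^sup>T * ?B * E)"
    using dim_col_Z by (intro mtrace_mult_commute) auto
  also have "N * E\<^sup>T * ?B * E = N * (E\<^sup>T * ?B * E)"
    using dim_col_Z by (simp add: assoc_mult_mat_dim)
  finally have 1: "mtrace (E * N * E\<^sup>T * ?B) = mtrace (N * (Y\<^sup>T * U * Y))"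
    unfolding E_form .
  have "outer v v * ?B = outer v (?B\<^sup>T *\<^sub>v v)"
    using dim_col_Z by (intro outer_mult) simp
  then have 2: "mtrace (outer v v * ?B) = r \<bullet> (U *\<^sub>v r)"
    unfolding form_sym using dim_col_Z by (simp add: mtrace_outer quadratic_v)
  have "mtrace (minv (Z\<^sup>T * Z) * ?B) =
      mtrace (E * N * E\<^sup>T * ?B) + 1 / (r \<bullet> r) * mtrace (outer v v * ?B)"
    using dim_col_Z unfolding minv_gram
    by (simp add: add_mult_mat_dim smult_mult_mat_dim mtrace_add mtrace_smult)
  then show ?thesis
    by (simp add: 1 2)
qed

section \<open>Increment of the second trace in \<open>df_R\<close>, with \<open>c\<close> given by
  its linear equation\<close>

context
  fixes S Sp M :: "real mat" and \<phi> c e :: "real vec" and a :: real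
  assumes dims_S [simp]: "dim_row S = Suc p" "dim_col S = Suc p" and S_sym: "S\<^sup>T = S"
    and dim_c [simp]: "dim_vec c = p"
  defines "Sp \<equiv> leading_block p S"
    and "\<phi> \<equiv> Matrix.vec p (\<lambda>i. S $$ (i, p))"
  assumes c: "Sp *\<^sub>v c = \<phi>"
  defines "M \<equiv> Y * N * Sp * N * Y\<^sup>T"
    and "e \<equiv> z - Y *\<^sub>v c"
    and "a \<equiv> S $$ (p, p) - \<phi> \<bullet> c"
begin

lemma dims_Sp [simp]: "dim_row Sp = p" "dim_col Sp = p" "dim_vec \<phi> = p" "dim_vec e = dim_row Z"
  by (simp_all add: Sp_def \<phi>_def e_def)

lemma Sp_eq: "Sp = E\<^sup>T * S * E"
  unfolding Sp_def E_def by (rule leading_block_eq_mult) auto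

lemma Sp_sym: "Sp\<^sup>T = Sp"
  by (simp add: Sp_eq transpose_mult_dim assoc_mult_mat_dim S_sym)

text \<open>\<open>S u\<close> is the last column of \<open>S\<close>, and \<open>E\<^sup>T\<close>
  drops its last entry.\<close>

lemma \<phi>_eq: "\<phi> = E\<^sup>T *\<^sub>v (S *\<^sub>v u)"
proof (rule eq_vecI)
  fix i assume "i < dim_vec (E\<^sup>T *\<^sub>v (S *\<^sub>v u))"
  then have i: "i < p" by simp
  have "Matrix.col E i = unit_vec (Suc p) i"
    using i by (auto intro!: eq_vecI simp: E_def unit_vec_def)
  moreover have "S *\<^sub>v u = Matrix.col S p"
    using mult_mat_vec_unit[of p S] by (simp add: u_def)
  ultimately show "\<phi> $ i = (E\<^sup>T *\<^sub>v (S *\<^sub>v u)) $ i"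
    using i by (simp add: \<phi>_def carrier_vecI)
qed simp

text \<open>Regressing \<open>Y c\<close> on \<open>Y\<close> returns \<open>c\<close>, so by
  linearity \<open>b - c\<close> holds the regression coefficients of \<open>e\<close>.\<close>

lemma b_minus_c: "b - c = N *\<^sub>v (Y\<^sup>T *\<^sub>v e)"
proof -
  have "N *\<^sub>v (Y\<^sup>T *\<^sub>v (Y *\<^sub>v c)) = N * (Y\<^sup>T * Y) *\<^sub>v c"
    by (simp add: assoc_mult_mat_vec_dim)
  also have "\<dots> = c"
    by (simp add: N(3) carrier_vecI)
  finally show ?thesis
    by (simp add: e_def b_def mult_minus_mat_vec_dim)
qed

text \<open>The first \<open>p\<close> entries of \<open>S v\<close> are
  \<open>Sp b - \<phi>\<close>, and \<open>\<phi> = Sp c\<close> by the equation for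
  \<open>c\<close>.\<close>

lemma E_S_v: "E\<^sup>T *\<^sub>v (S *\<^sub>v v) = Sp *\<^sub>v (b - c)"
proof -
  have "E\<^sup>T *\<^sub>v (S *\<^sub>v v) = Sp *\<^sub>v b - \<phi>"
    by (simp add: v_def mult_minus_mat_vec_dim \<phi>_eq Sp_eq assoc_mult_mat_vec_dim)
  then show ?thesis
    by (simp add: mult_minus_mat_vec_dim c)
qed

text \<open>The left factor lies in the range of \<open>E\<close>, so only the part
  \<open>Sp (b - c)\<close> of \<open>S v\<close> counts. Inserting
  \<open>b - c = N Y\<^sup>T e\<close> and moving \<open>N\<close>, \<open>Y\<close> and
  \<open>U\<close> across the scalar product assembles \<open>U M\<close>; the sign comes from
  \<open>Z v = -r\<close>.\<close>

lemma cross_term: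
  "(E * N * E\<^sup>T *\<^sub>v (Z\<^sup>T * U * Z *\<^sub>v v)) \<bullet> (S *\<^sub>v v) = - (r \<bullet> (U * M *\<^sub>v e))"
proof -
  let ?g = "N *\<^sub>v (Y\<^sup>T *\<^sub>v (U *\<^sub>v r))"
  have "E * N * E\<^sup>T *\<^sub>v (Z\<^sup>T * U * Z *\<^sub>v v) = E *\<^sub>v (N *\<^sub>v ((Z * E)\<^sup>T *\<^sub>v (U *\<^sub>v (Z *\<^sub>v v))))"
    using dim_col_Z by (simp add: assoc_mult_mat_vec_dim transpose_mult_dim)
  also have "\<dots> = - (E *\<^sub>v ?g)"
    using dim_col_Z by (simp add: Z_mult_v Z_mult_E mult_uminus_mat_vec_dim)
  finally have "(E * N * E\<^sup>T *\<^sub>v (Z\<^sup>T * U * Z *\<^sub>v v)) \<bullet> (S *\<^sub>v v) = - ((E *\<^sub>v ?g) \<bullet> (S *\<^sub>v v))"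
    by (simp add: scalar_prod_uminus_dim)
  also have "(E *\<^sub>v ?g) \<bullet> (S *\<^sub>v v) = ?g \<bullet> (E\<^sup>T *\<^sub>v (S *\<^sub>v v))"
    by (simp add: scalar_prod_mult_mat_vec_dim[of ?g "E\<^sup>T"])
  also have "\<dots> = ?g \<bullet> (Sp *\<^sub>v (N *\<^sub>v (Y\<^sup>T *\<^sub>v e)))"
    by (simp add: E_S_v b_minus_c)
  also have "\<dots> = r \<bullet> (U *\<^sub>v (Y *\<^sub>v (N *\<^sub>v (Sp *\<^sub>v (N *\<^sub>v (Y\<^sup>T *\<^sub>v e))))))"
    by (simp add: scalar_prod_mult_mat_vec_dim[of r U] U_sym
        scalar_prod_mult_mat_vec_dim[of "U *\<^sub>v r" Y]
        scalar_prod_mult_mat_vec_dim[of "Y\<^sup>T *\<^sub>v (U *\<^sub>v r)" N] transpose_N)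
  also have "\<dots> = r \<bullet> (U * M *\<^sub>v e)"
    by (simp add: M_def assoc_mult_mat_vec_dim)
  finally show ?thesis .
qed

text \<open>Completing the square: with \<open>\<phi> = Sp c\<close>, the form at
  \<open>v = (b, -1)\<close> is that of \<open>Sp\<close> at \<open>b - c\<close> plus the Schur
  complement \<open>a\<close>. The former equals the form of \<open>M\<close> at
  \<open>e\<close>.\<close>

lemma quadratic_S_v: "v \<bullet> (S *\<^sub>v v) = e \<bullet> (M *\<^sub>v e) + a"
proof -
  have uS: "u \<bullet> (S *\<^sub>v (E *\<^sub>v b)) = b \<bullet> \<phi>"
    by (simp add: \<phi>_eq scalar_prod_mult_mat_vec_dim[of u S] S_sym
        scalar_prod_mult_mat_vec_dim[of b "E\<^sup>T"] scalar_prod_comm_dim)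
  have uu: "u \<bullet> (S *\<^sub>v u) = S $$ (p, p)"
    using mult_mat_vec_unit[of p S] by (simp add: u_def carrier_vecI)
  have "v \<bullet> (S *\<^sub>v v) = (E *\<^sub>v b) \<bullet> (S *\<^sub>v v) - u \<bullet> (S *\<^sub>v v)"
    by (subst (1) v_def) (simp add: scalar_prod_minus_dim)
  also have "(E *\<^sub>v b) \<bullet> (S *\<^sub>v v) = b \<bullet> (Sp *\<^sub>v (b - c))"
    using scalar_prod_mult_mat_vec_dim[of b "E\<^sup>T" "S *\<^sub>v v"] by (simp add: E_S_v)
  also have "u \<bullet> (S *\<^sub>v v) = b \<bullet> \<phi> - S $$ (p, p)"
    by (simp add: v_def mult_minus_mat_vec_dim scalar_prod_minus_dim uS uu)
  finally have 1: "v \<bullet> (S *\<^sub>v v) = b \<bullet> (Sp *\<^sub>v b) - 2 * (b \<bullet> \<phi>) + S $$ (p, p)"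
    by (simp add: mult_minus_mat_vec_dim scalar_prod_minus_dim c)
  have "e \<bullet> (M *\<^sub>v e) = e \<bullet> (Y *\<^sub>v (N *\<^sub>v (Sp *\<^sub>v (N *\<^sub>v (Y\<^sup>T *\<^sub>v e)))))"
    by (simp add: M_def assoc_mult_mat_vec_dim)
  also have "\<dots> = (b - c) \<bullet> (Sp *\<^sub>v (b - c))"
    by (simp add: b_minus_c scalar_prod_mult_mat_vec_dim[of e Y]
        scalar_prod_mult_mat_vec_dim[of "Y\<^sup>T *\<^sub>v e" N] transpose_N)
  also have "\<dots> = b \<bullet> (Sp *\<^sub>v b) - b \<bullet> \<phi> - (c \<bullet> (Sp *\<^sub>v b) - c \<bullet> \<phi>)"
    by (simp add: mult_minus_mat_vec_dim scalar_prod_minus_dim c)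
  also have "c \<bullet> (Sp *\<^sub>v b) = b \<bullet> \<phi>"
    by (simp add: scalar_prod_mult_mat_vec_dim[of c Sp] Sp_sym c scalar_prod_comm_dim[of b])
  finally show ?thesis
    using 1 by (simp add: a_def scalar_prod_comm_dim[of c])
qed

text \<open>Both inverses split into a padded and a rank-one part, which gives four traces. The two
  mixed ones agree, as transposition and cycling exchange them for symmetric \<open>B\<close>,
  \<open>K\<close>, \<open>S\<close>; hence the factor 2. The doubly rank-one trace factors into two
  quadratic forms at \<open>v\<close>.\<close>

lemma mtrace_sandwich_increment:
  "mtrace (minv (Z\<^sup>T * Z) * (Z\<^sup>T * U * Z) * minv (Z\<^sup>T * Z) * S) =
     mtrace (N * (Y\<^sup>T * U * Y) * N * Sp)
     - 2 * (r \<bullet> (U * M *\<^sub>v e)) / (r \<bullet> r)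
     + (r \<bullet> (U *\<^sub>v r)) * (e \<bullet> (M *\<^sub>v e) + a) / (r \<bullet> r)\<^sup>2"
proof -
  let ?B = "Z\<^sup>T * U * Z" and ?K = "E * N * E\<^sup>T" and ?R = "outer v v" and ?k = "1 / (r \<bullet> r)"
  define B K where "B = ?B" and "K = ?K"
  have [simp]: "dim_row B = Suc p" "dim_col B = Suc p" "dim_row K = Suc p" "dim_col K = Suc p"
    using dim_col_Z by (auto simp: B_def K_def)
  have BT: "B\<^sup>T = B"
    unfolding B_def by (rule form_sym)
  have KT: "K\<^sup>T = K"
    by (simp add: K_def transpose_mult_dim assoc_mult_mat_dim transpose_N)
  have "mtrace ((K + ?k \<cdot>\<^sub>m ?R) * B * (K + ?k \<cdot>\<^sub>m ?R) * S) =
      mtrace (K * B * K * S) + ?k * mtrace (?R * B * K * S)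
      + (?k * mtrace (K * B * ?R * S) + ?k * (?k * mtrace (?R * B * ?R * S)))"
    by (simp add: add_mult_mat_dim mult_add_mat_dim smult_mult_mat_dim mult_smult_mat_dim
        mtrace_add mtrace_smult distrib_left)
  also have "mtrace (K * B * K * S) = mtrace (N * (Y\<^sup>T * U * Y) * N * Sp)"
  proof -
    \<comment> \<open>Cycling the first \<open>E\<close> to the end places both \<open>B\<close> and
      \<open>S\<close> between \<open>E\<^sup>T\<close> and \<open>E\<close>.\<close>
    have "mtrace (K * B * K * S) = mtrace (E * (N * E\<^sup>T * B * K * S))"
      by (simp add: K_def assoc_mult_mat_dim)
    also have "\<dots> = mtrace (N * E\<^sup>T * B * K * S * E)"
      by (intro mtrace_mult_commute) auto
    also have "N * E\<^sup>T * B * K * S * E = N * (E\<^sup>T * B * E) * N * (E\<^sup>T * S * E)"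
      by (simp add: K_def assoc_mult_mat_dim)
    finally show ?thesis
      by (simp add: B_def E_form Sp_eq)
  qed
  also have "mtrace (K * B * ?R * S) = (K *\<^sub>v (B *\<^sub>v v)) \<bullet> (S *\<^sub>v v)"
    by (simp add: mult_outer outer_mult S_sym mtrace_outer assoc_mult_mat_vec_dim)
  also have "mtrace (?R * B * K * S) = v \<bullet> (S *\<^sub>v (K *\<^sub>v (B *\<^sub>v v)))"
    by (simp add: outer_mult S_sym BT KT mtrace_outer)
  also have "\<dots> = (K *\<^sub>v (B *\<^sub>v v)) \<bullet> (S *\<^sub>v v)"
    by (simp add: scalar_prod_mult_mat_vec_dim[of v S] S_sym scalar_prod_comm_dim[of "S *\<^sub>v v"])
  also have "(K *\<^sub>v (B *\<^sub>v v)) \<bullet> (S *\<^sub>v v) = - (r \<bullet> (U * M *\<^sub>v e))"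
    unfolding K_def B_def by (rule cross_term)
  also have "mtrace (?R * B * ?R * S) = (v \<bullet> (B *\<^sub>v v)) * (v \<bullet> (S *\<^sub>v v))"
    by (simp add: mult_outer outer_mult S_sym BT mtrace_outer outer_mult_vec
        scalar_prod_comm_dim[of v "B *\<^sub>v v"])
  also have "v \<bullet> (B *\<^sub>v v) = r \<bullet> (U *\<^sub>v r)"
    unfolding B_def by (rule quadratic_v)
  finally show ?thesis
    unfolding minv_gram quadratic_S_v K_def B_def by (simp add: field_simps power2_eq_square)
qed

end

end

end

section \<open>Degrees of freedom of the weighted design\<close>

text \<open>With \<open>L\<close> the leading columns, \<open>L\<^sup>T W L = m Z\<^sup>T Z\<close>
  and \<open>L\<^sup>T W T W L = m\<^sup>2 Z\<^sup>T U Z\<close>. The powers of \<open>m\<close>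
  cancel: \<open>df_F\<close> has one inverse and the prefactor \<open>1 / m\<close>, while the
  second trace of \<open>df_R\<close> has two inverses.\<close>

lemma df_eq_gram:
  fixes w \<tau> :: "nat \<Rightarrow> real" and X S :: "real mat" and q :: nat
  assumes X: "X \<in> carrier_mat n d" "trivial_kernel X" and q: "q \<le> d" and n: "0 < n"
    and w: "\<And>i. i < n \<Longrightarrow> w i > 0"
  defines "m \<equiv> mean_weight n w" and "Wh \<equiv> mat_diag n (\<lambda>i. sqrt (w i))"
  defines "Z \<equiv> (1 / sqrt m) \<cdot>\<^sub>m (Wh * leading_cols q X)"
    and "U \<equiv> (1 / m) \<cdot>\<^sub>m (Wh * mat_diag n \<tau> * Wh)"
  shows "trivial_kernel Z"
    and "df_F w \<tau> X q = mtrace (minv (Z\<^sup>T * Z) * (Z\<^sup>T * U * Z))"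
    and "df_R w \<tau> S X q = 1 / 2 * df_F w \<tau> X q + real n / 2 *
      mtrace (minv (Z\<^sup>T * Z) * (Z\<^sup>T * U * Z) * minv (Z\<^sup>T * Z) * leading_block q S)"
proof -
  define L where "L = leading_cols q X"
  have m: "m > 0"
    unfolding m_def mean_weight_def using n w by (intro divide_pos_pos sum_pos) auto
  have dL [simp]: "dim_row L = n" "dim_col L = q"
    using X by (auto simp: L_def)
  have dW [simp]: "dim_row Wh = n" "dim_col Wh = n"
    by (simp_all add: Wh_def)
  have dZ [simp]: "dim_row Z = n" "dim_col Z = q"
    by (simp_all add: Z_def L_def[symmetric])
  have dU [simp]: "dim_row U = n" "dim_col U = n"
    by (simp_all add: U_def)
  have WT: "Wh\<^sup>T = Wh"
    by (simp add: Wh_def transpose_mat_diag)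
  have WW: "mat_diag n w = Wh * Wh"
    unfolding Wh_def mat_diag_diag using w by (intro eq_matI) (auto simp: mat_diag_def less_imp_le)
  show ker: "trivial_kernel Z"
    unfolding Z_def Wh_def using X q m w
    by (intro trivial_kernel_smult trivial_kernel_mult trivial_kernel_leading_cols
        trivial_kernel_mat_diag) (auto simp: less_imp_neq[symmetric])
  have sm: "1 / sqrt m * (1 / sqrt m) = 1 / m"
    using m by (simp add: real_sqrt_mult_self)
  have gram: "L\<^sup>T * mat_diag n w * L = m \<cdot>\<^sub>m (Z\<^sup>T * Z)"
  proof -
    have "Z\<^sup>T * Z = (1 / sqrt m * (1 / sqrt m)) \<cdot>\<^sub>m (L\<^sup>T * mat_diag n w * L)"
      unfolding WW by (simp only: Z_def L_def[symmetric] transpose_smult smult_mult_mat_dim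
          mult_smult_mat_dim smult_smult_mat transpose_mult_dim assoc_mult_mat_dim WT dL dW
          index_mult_mat index_transpose_mat index_smult_mat)
    then show ?thesis
      unfolding sm using m by (auto intro!: eq_matI)
  qed
  have form: "L\<^sup>T * mat_diag n w * mat_diag n \<tau> * mat_diag n w * L = m\<^sup>2 \<cdot>\<^sub>m (Z\<^sup>T * U * Z)"
  proof -
    have "Z\<^sup>T * U * Z = (1 / sqrt m * (1 / m * (1 / sqrt m))) \<cdot>\<^sub>m
        (L\<^sup>T * mat_diag n w * mat_diag n \<tau> * mat_diag n w * L)"
      unfolding WW by (simp only: Z_def U_def L_def[symmetric] transpose_smult smult_mult_mat_dim
          mult_smult_mat_dim smult_smult_mat transpose_mult_dim assoc_mult_mat_dim WT dL dW
          index_mult_mat index_transpose_mat index_smult_mat dim_mat_diag mult.assoc)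
    moreover have "1 / sqrt m * (1 / m * (1 / sqrt m)) = 1 / m\<^sup>2"
      using sm by (simp add: power2_eq_square)
    ultimately show ?thesis
      using m by (auto intro!: eq_matI)
  qed
  have G: "Z\<^sup>T * Z \<in> carrier_mat q q"
    by (rule carrier_matI) simp_all
  note Gker = trivial_kernel_gram[OF ker]
  have inv: "minv (m \<cdot>\<^sub>m (Z\<^sup>T * Z)) = (1 / m) \<cdot>\<^sub>m minv (Z\<^sup>T * Z)"
    using minv_smult[OF G Gker] m by simp
  have dN [simp]: "dim_row (minv (Z\<^sup>T * Z)) = q" "dim_col (minv (Z\<^sup>T * Z)) = q"
    using minv_trivial_kernel(1)[OF G Gker] by auto
  have nX: "dim_row X = n"
    using X by simp
  show "df_F w \<tau> X q = mtrace (minv (Z\<^sup>T * Z) * (Z\<^sup>T * U * Z))"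
    unfolding df_F_def Let_def nX L_def[symmetric] gram form inv m_def[symmetric]
    using m by (simp add: smult_mult_mat_dim mult_smult_mat_dim mtrace_smult power2_eq_square)
  show "df_R w \<tau> S X q = 1 / 2 * df_F w \<tau> X q + real n / 2 *
      mtrace (minv (Z\<^sup>T * Z) * (Z\<^sup>T * U * Z) * minv (Z\<^sup>T * Z) * leading_block q S)"
    unfolding df_R_def Let_def nX L_def[symmetric] gram form inv
    using m by (simp add: smult_mult_mat_dim mult_smult_mat_dim mtrace_smult power2_eq_square)
qed

section \<open>The increment of \<open>df_R\<close> at a realised design\<close>

theorem theorem4p2:
  fixes P :: "'s measure" and n d p :: nat
    and x :: "nat \<Rightarrow> 's \<Rightarrow> real vec" and xstar y :: "'s \<Rightarrow> real vec"
    and w \<tau> :: "real vec \<Rightarrow> real" and \<sigma>\<^sub>\<epsilon> :: real and \<omega> :: 's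
    and X T \<Sigma> \<Sigma>p Wh Xt H U M :: "real mat" and wbar \<sigma>2 a :: real
    and wi \<tau>i :: "nat \<Rightarrow> real" and \<phi> xt r e :: "real vec" and \<Delta>F \<Delta>R :: real
  assumes "prob_space P"
    and "\<And>i. i < n \<Longrightarrow> x i \<in> P \<rightarrow>\<^sub>M vec_borel d"
    and "xstar \<in> P \<rightarrow>\<^sub>M vec_borel d"
    and "y \<in> P \<rightarrow>\<^sub>M vec_borel n"
    and "\<And>i. i < n \<Longrightarrow> distr P (vec_borel d) xstar = distr P (vec_borel d) (x i)"
    and "prob_space.indep_set P (sets (vimage_algebra (space P) xstar (vec_borel d)))
           (sets (design_algebra P n d x))"
    and "\<And>v. v \<in> carrier_vec d \<Longrightarrow> w v > 0"
    and "\<And>v. v \<in> carrier_vec d \<Longrightarrow> \<tau> v > 0"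
    and "\<sigma>\<^sub>\<epsilon>\<^sup>2 > 0"
    and "AE \<omega>' in P. cond_var P (design_algebra P n d x) n y \<omega>' =
           \<sigma>\<^sub>\<epsilon>\<^sup>2 \<cdot>\<^sub>m mat_diag n (\<lambda>i. \<tau> (x i \<omega>'))"
    and "\<And>j k. j < d \<Longrightarrow> k < d \<Longrightarrow>
           integrable P (\<lambda>\<omega>'. w (xstar \<omega>') * (xstar \<omega>' $ j * xstar \<omega>' $ k))"
    and "\<omega> \<in> space P"
    and "X = design_matrix n d x \<omega>"
    and "wi = (\<lambda>i. w (x i \<omega>))"
    and "\<tau>i = (\<lambda>i. \<tau> (x i \<omega>))"
    and "wbar = mean_weight n wi"
    and "\<Sigma> = Sigma_mat P d w xstar wbar"
    and "vec_space.rank n X = d"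
    and "pos_def_mat d \<Sigma>"
    and "p < d" and "d < n"
    and "T = mat_diag n \<tau>i"
    and "Wh = mat_diag n (\<lambda>i. sqrt (wi i))"
    and "\<Sigma>p = leading_block p \<Sigma>"
    and "\<phi> = Matrix.vec p (\<lambda>i. \<Sigma> $$ (i, p))"
    and "\<sigma>2 = \<Sigma> $$ (p, p)"
    and "a = \<sigma>2 - \<phi> \<bullet> (minv \<Sigma>p *\<^sub>v \<phi>)"
    and "Xt = (1 / sqrt wbar) \<cdot>\<^sub>m (Wh * leading_cols p X)"
    and "xt = (1 / sqrt wbar) \<cdot>\<^sub>v (Wh *\<^sub>v Matrix.col X p)"
    and "H = Xt * minv (Xt\<^sup>T * Xt) * Xt\<^sup>T"
    and "r = (1\<^sub>m n - H) *\<^sub>v xt"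
    and "U = (1 / wbar) \<cdot>\<^sub>m (Wh * T * Wh)"
    and "M = Xt * minv (Xt\<^sup>T * Xt) * \<Sigma>p * minv (Xt\<^sup>T * Xt) * Xt\<^sup>T"
    and "e = xt - Xt *\<^sub>v (minv \<Sigma>p *\<^sub>v \<phi>)"
    and "\<Delta>F = df_F wi \<tau>i X (p + 1) - df_F wi \<tau>i X p"
    and "\<Delta>R = df_R wi \<tau>i \<Sigma> X (p + 1) - df_R wi \<tau>i \<Sigma> X p"
  shows "\<Delta>R = 1 / 2 * \<Delta>F
      + real n / 2 * \<Delta>F * ((mat_sqnorm M e + a) / (eucl_norm r)\<^sup>2)
      - real n * (mat_ip (U * M) r e / (eucl_norm r)\<^sup>2)"
proof -
  \<comment> \<open>The argument is pointwise at the fixed outcome \<open>\<omega>\<close>.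
    Measurability places the rows in the carrier on which \<open>w\<close> is positive.\<close>
  have x: "x i \<omega> \<in> carrier_vec d" if "i < n" for i
    using measurable_space[OF assms(2)[OF that] assms(12)] by (simp add: vec_borel_def)
  have w: "wi i > 0" if "i < n" for i
    using assms(7)[OF x[OF that]] assms(14) by simp
  have X: "X \<in> carrier_mat n d"
    unfolding assms(13) design_matrix_def by (rule carrier_matI) simp_all
  then have dX: "dim_row X = n" "dim_col X = d"
    by auto
  have kX: "trivial_kernel X"
    by (rule trivial_kernel_full_rank[OF X assms(18)])
  have n: "0 < n" and p: "p \<le> d" "Suc p \<le> d"
    using \<open>p < d\<close> \<open>d < n\<close> by auto
  note ker = df_eq_gram(1)[where w = wi, OF X kX _ n w, folded assms(16,23)]
  note df = df_eq_gram(2,3)[where w = wi and \<tau> = \<tau>i, OF X kX _ n w, folded assms(16,22,23), folded assms(32)]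

  \<comment> \<open>With indices from 0, column \<open>p\<close> is the variable that enters, so
    \<open>Xt\<close> and \<open>xt\<close> are the first \<open>p\<close> columns and the last
    column of \<open>Z\<close>.\<close>
  define Z where "Z = (1 / sqrt wbar) \<cdot>\<^sub>m (Wh * leading_cols (Suc p) X)"
  have dW: "dim_row Wh = n" "dim_col Wh = n"
    using assms(23) by auto
  note df_p = df[OF p(1), folded assms(28)]
  note df_Suc = df[OF p(2), folded Z_def]
  have dZ: "dim_row Z = n" "dim_col Z = Suc p"
    by (auto simp: Z_def dW)
  interpret B: bordered_matrix Z p
    using dZ ker[OF p(2), folded Z_def] by unfold_locales auto
  have Xt: "Xt = B.Y"
    unfolding B.Y_def unfolding Z_def assms(28) using p dX dW by (intro eq_matI) auto
  have xt: "xt = B.z"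
    unfolding B.z_def unfolding Z_def assms(29) using p dX dW by (intro eq_vecI) auto
  have N: "minv (Xt\<^sup>T * Xt) = B.N"
    by (simp add: B.N_def Xt)
  \<comment> \<open>Applying \<open>1 - H\<close> to \<open>xt\<close> subtracts
    \<open>Y (N (Y\<^sup>T z))\<close>, which is \<open>Y b\<close>.\<close>
  have r: "r = B.r"
  proof -
    have "dim_row H = n" "dim_col H = n"
      unfolding assms(30) N by (auto simp: Xt dZ)
    then have "r = xt - H *\<^sub>v xt"
      unfolding assms(31) by (simp add: minus_mult_mat_vec_dim xt dZ carrier_vecI)
    then show ?thesis
      unfolding assms(30) N by (simp add: B.r_def B.b_def Xt xt assoc_mult_mat_vec_dim)
  qed
  have dU: "dim_row U = dim_row Z" "dim_col U = dim_row Z"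
    using assms(32) dW dZ by auto
  have U_sym: "U\<^sup>T = U"
    unfolding assms(32,22,23)
    by (simp add: transpose_smult transpose_mult_dim transpose_mat_diag assoc_mult_mat_dim)
  have \<Sigma>: "dim_row \<Sigma> = d" "dim_col \<Sigma> = d" "\<Sigma>\<^sup>T = \<Sigma>"
    using assms(19) by (auto simp: pos_def_mat_def)
  \<comment> \<open>This is the covariance block of the larger model; \<open>\<Sigma>p\<close>,
    \<open>\<phi>\<close> and \<open>\<sigma>2\<close> are its pieces.\<close>
  define S where "S = leading_block (Suc p) \<Sigma>"
  have dS: "dim_row S = Suc p" "dim_col S = Suc p"
    by (auto simp: S_def)
  have S_sym: "S\<^sup>T = S"
    unfolding S_def leading_block_eq_mult[OF \<Sigma>(1,2) p(2)]
    by (simp add: transpose_mult_dim assoc_mult_mat_dim \<Sigma>)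
  have \<Sigma>p: "\<Sigma>p = leading_block p S"
    unfolding assms(24) S_def by (intro eq_matI) (auto simp: leading_block_def)
  have \<phi>: "\<phi> = Matrix.vec p (\<lambda>i. S $$ (i, p))"
    unfolding assms(25) S_def by (intro eq_vecI) (auto simp: leading_block_def)
  have \<sigma>2: "\<sigma>2 = S $$ (p, p)"
    unfolding assms(26) S_def by (simp add: leading_block_def)
  have "\<Sigma>p \<in> carrier_mat p p"
    by (auto simp: \<Sigma>p)
  \<comment> \<open>Positive definiteness of \<open>\<Sigma>\<close> makes \<open>\<Sigma>p\<close>
    invertible, so that \<open>minv \<Sigma>p *\<^sub>v \<phi>\<close> solves the equation required
    of \<open>c\<close>.\<close>
  note inv = minv_trivial_kernel[OF this trivial_kernel_leading_block[OF assms(19) p(1), folded assms(24)]]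
  have dc: "dim_vec (minv \<Sigma>p *\<^sub>v \<phi>) = p"
    using inv(1) by auto
  have "\<Sigma>p *\<^sub>v (minv \<Sigma>p *\<^sub>v \<phi>) = \<Sigma>p * minv \<Sigma>p *\<^sub>v \<phi>"
    using inv(1) by (subst assoc_mult_mat_vec_dim) (auto simp: \<Sigma>p \<phi>)
  also have "\<dots> = \<phi>"
    by (simp add: inv(2) \<phi> carrier_vecI)
  finally have c: "leading_block p S *\<^sub>v (minv \<Sigma>p *\<^sub>v \<phi>) = Matrix.vec p (\<lambda>i. S $$ (i, p))"
    using \<Sigma>p \<phi> by simp
  have rr: "(eucl_norm r)\<^sup>2 = B.r \<bullet> B.r"
    using B.r_sq_pos by (simp add: eucl_norm_def r)
  have F: "\<Delta>F = (B.r \<bullet> (U *\<^sub>v B.r)) / (B.r \<bullet> B.r)"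
    unfolding assms(35) using B.mtrace_increment[OF dU U_sym]
    by (simp add: df_p(1) df_Suc(1) Xt B.N_def)
  have M: "M = B.Y * B.N * leading_block p S * B.N * B.Y\<^sup>T"
    unfolding assms(33) N unfolding \<Sigma>p Xt ..
  have e: "e = B.z - B.Y *\<^sub>v (minv \<Sigma>p *\<^sub>v \<phi>)"
    unfolding assms(34) Xt xt ..
  have a: "a = S $$ (p, p) - Matrix.vec p (\<lambda>i. S $$ (i, p)) \<bullet> (minv \<Sigma>p *\<^sub>v \<phi>)"
    unfolding assms(27) \<sigma>2 using \<phi> by simp
  have "\<Delta>R = 1 / 2 * \<Delta>F + real n / 2 *
      (mtrace (minv (Z\<^sup>T * Z) * (Z\<^sup>T * U * Z) * minv (Z\<^sup>T * Z) * S) -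
       mtrace (B.N * (B.Y\<^sup>T * U * B.Y) * B.N * leading_block p S))"
    using df_p(2)[of \<Sigma>] df_Suc(2)[of \<Sigma>]
    by (simp add: assms(35,36) S_def[symmetric] B.N_def Xt \<Sigma>p assms(24)[symmetric] algebra_simps)
  \<comment> \<open>Of the two factors \<open>1 / (r \<bullet> r)\<close> in the last term of the
    increment, one is absorbed into \<open>\<Delta>F\<close> and the other remains as the
    denominator.\<close>
  also have "\<dots> = 1 / 2 * \<Delta>F + real n / 2 *
      (- 2 * (B.r \<bullet> (U * M *\<^sub>v e)) / (B.r \<bullet> B.r) + \<Delta>F * ((e \<bullet> (M *\<^sub>v e) + a) / (B.r \<bullet> B.r)))"
    unfolding B.mtrace_sandwich_increment[OF dU U_sym dS S_sym dc c, folded M e a] F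
    by (simp add: power2_eq_square)
  finally show ?thesis
    unfolding rr mat_sqnorm_def mat_ip_def unfolding r using B.r_sq_pos by (simp add: field_simps)
qed

end
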